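(* Let $(\Delta_n)_{n\ge 1}$ be a sequence of positive real numbers and consider the Pólya urn with expanding colors with reinforcement parameters $(\Delta_n)_{n\ge1}$. Fix $t\geq 1$ and a color $c_j$ with $1\leq j\leq t$, and let $N_{j,t}=\sum_{n=j}^{t}Z_{j,n}$ be the number of draws of color $c_j$ up to and including time $t$. Then, for $1\leq k\leq t-j+1$, $$P(N_{j,t}=k)=\sum_{(i_1,\dots,i_k)\in \mathcal{A}_{j,k}^{(t)}}\frac{\prod_{a=1}^{k}\Big(1+\sum_{b=1}^{a-1}\Delta_{i_b}\Big)\ \prod_{p=j,\;p\notin\{i_1,\dots,i_k\}}^{t}\Big((p-1)+\sum_{l=1,\;l\notin\{i_1,\dots,i_k\}}^{p-1}\Delta_l\Big)}{\prod_{n=j-1}^{t-1}\Big((n+1)+\sum_{m=1}^{n}\Delta_m\Big)},$$ and for $k=0$, $$P(N_{j,t}=0)=\frac{\prod_{p=j}^{t}\Big((p-1)+\sum_{l=1}^{p-1}\Delta_l\Big)}{\prod_{n=j-1}^{t-1}\Big((n+1)+\sum_{m=1}^{n}\Delta_m\Big)},$$ where $$\mathcal{A}_{j,k}^{(t)}=\begin{cases}\{(i_1,\dots,i_k)\mid 1=i_1<i_2<\cdots<i_k\leq t\} & \text{for } j=1,\\ \{(i_1,\dots,i_k)\mid j\leq i_1<i_2<\cdots<i_k\leq t\} & \text{for } 1<j\leq t,\end{cases}$$ the $i_r$ being integers.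
   Context: Pólya urn with expanding colors and reinforcement parameters $(\Delta_n)_{n\ge1}$ (deterministic positive reals, not necessarily integers; "number of balls" of a color is a nonnegative real amount). At time $0$ the urn contains a single ball, of color $c_1$. At each time $t\ge 1$ a ball is drawn from the urn: conditionally on all past draws, the color drawn at time $t$ is $c_j$ ($1\le j\le t$) with probability equal to the number of balls of color $c_j$ in the urn at time $t-1$ divided by the total number of balls in the urn at time $t-1$. The drawn ball is returned to the urn together with $\Delta_t$ additional balls of the same color, and one ball of a new color $c_{t+1}$ is also added. (In particular the draw at time $1$ is deterministic and has color $c_1$.) For $1\le j\le t$, $Z_{j,t}=1$ if a ball of color $c_j$ is drawn at time $t$, and $Z_{j,t}=0$ otherwise. Empty sums equal $0$ and empty products equal $1$. *)

theory Defs
  imports "HOL-Probability.Probability"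
begin

text \<open>
  The color \<open>c\<^sub>j\<close> is represented by its index \<open>j \<ge> 1\<close>. A sequence \<open>c\<close> of draws assigns to each
  time \<open>s \<ge> 1\<close> the index \<open>c s\<close> of the color drawn at that time; \<open>\<Delta> 0\<close> and \<open>c 0\<close> are never used.
  \<open>balls \<Delta> c t j\<close> is the (real) number of balls of color \<open>j\<close> after the first \<open>t\<close> draws.
\<close>

primrec balls :: "(nat \<Rightarrow> real) \<Rightarrow> (nat \<Rightarrow> nat) \<Rightarrow> nat \<Rightarrow> nat \<Rightarrow> real" where
  "balls \<Delta> c 0 = (\<lambda>j. if j = 1 then 1 else 0)"
| "balls \<Delta> c (Suc t) = (\<lambda>j. balls \<Delta> c t j
      + (if j = c (Suc t) then \<Delta> (Suc t) else 0)
      + (if j = Suc t + 1 then 1 else 0))"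

definition total_balls :: "(nat \<Rightarrow> real) \<Rightarrow> (nat \<Rightarrow> nat) \<Rightarrow> nat \<Rightarrow> real" where
  "total_balls \<Delta> c t = (\<Sum>j=1..t + 1. balls \<Delta> c t j)"

text \<open>
  \<open>C t\<close> is the index of the color drawn at time \<open>t \<ge> 1\<close>. The law of each draw is prescribed
  conditionally on every past \<open>C 1 = c 1, \<dots>, C (t - 1) = c (t - 1)\<close> of positive probability
  (for \<open>t = 1\<close> the past is the sure event).
\<close>

locale expanding_polya_urn = prob_space M
  for M :: "'a measure" +
  fixes \<Delta> :: "nat \<Rightarrow> real" and C :: "nat \<Rightarrow> 'a \<Rightarrow> nat"
  assumes reinforcement_pos: "\<And>n. n \<ge> 1 \<Longrightarrow> \<Delta> n > 0"
    and draw_measurable: "\<And>t. t \<ge> 1 \<Longrightarrow> C t \<in> measurable M (count_space UNIV)"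
    and draw_law: "\<And>t j c. 1 \<le> j \<Longrightarrow> j \<le> t \<Longrightarrow>
      \<P>(\<omega> in M. \<forall>s\<in>{1..<t}. C s \<omega> = c s) > 0 \<Longrightarrow>
      \<P>(\<omega> in M. C t \<omega> = j \<bar> \<forall>s\<in>{1..<t}. C s \<omega> = c s)
        = balls \<Delta> c (t - 1) j / total_balls \<Delta> c (t - 1)"

definition drawn :: "(nat \<Rightarrow> 'a \<Rightarrow> nat) \<Rightarrow> nat \<Rightarrow> nat \<Rightarrow> 'a \<Rightarrow> nat" where
  "drawn C j t \<omega> = (if C t \<omega> = j then 1 else 0)"

definition num_draws :: "(nat \<Rightarrow> 'a \<Rightarrow> nat) \<Rightarrow> nat \<Rightarrow> nat \<Rightarrow> 'a \<Rightarrow> nat" where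
  "num_draws C j t \<omega> = (\<Sum>n=j..t. drawn C j n \<omega>)"

text \<open>
  A tuple \<open>(i\<^sub>1, \<dots>, i\<^sub>k)\<close> is a function on \<open>{1..k}\<close>, extensional so that distinct functions are
  distinct tuples. Only used for \<open>k \<ge> 1\<close>.
\<close>

definition draw_times :: "nat \<Rightarrow> nat \<Rightarrow> nat \<Rightarrow> (nat \<Rightarrow> nat) set" where
  "draw_times j k t =
    (if j = 1
     then {i \<in> {1..k} \<rightarrow>\<^sub>E UNIV. i 1 = 1 \<and> strict_mono_on {1..k} i \<and> i k \<le> t}
     else {i \<in> {1..k} \<rightarrow>\<^sub>E UNIV. j \<le> i 1 \<and> strict_mono_on {1..k} i \<and> i k \<le> t})"

end

theory Submission
  imports Defs
begin

text \<open>
  Before time \<open>p\<close> the urn holds \<open>T\<^sub>p = p + \<Delta>\<^sub>1 + \<dots> + \<Delta>\<^sub>p\<^sub>-\<^sub>1\<close> balls, whatever was drawn. The color \<open>j\<close>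
  enters as a single ball after the draw at time \<open>j - 1\<close> (at time \<open>0\<close> if \<open>j = 1\<close>), and for \<open>p \<ge> j\<close> its
  amount before time \<open>p\<close> is \<open>1\<close> plus the sum of \<open>\<Delta>\<^sub>l\<close> over the times \<open>l < p\<close> at which it was drawn. So
  the conditional probability of drawing \<open>j\<close> at time \<open>p\<close> depends on the past only through the set of
  earlier draw times of \<open>j\<close>.

  Fix a set \<open>I \<subseteq> {j..t}\<close>. Multiplying the conditional probabilities along \<open>p = j, \<dots>, t\<close> shows that
  \<open>j\<close> is drawn exactly at the times in \<open>I\<close> with probability \<open>\<Prod>\<^sub>p w\<^sub>p(I) / T\<^sub>p\<close>
  (\<open>prob_histories_with\<close>). Here \<open>w\<^sub>p(I)\<close>, called \<open>draw_weight\<close>, is the amount of color \<open>j\<close> if \<open>p \<in> I\<close>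
  and the amount of all other colors if \<open>p \<notin> I\<close>; the latter is
  \<open>T\<^sub>p - 1 - \<Sum>\<^sub>l\<^sub>\<in>\<^sub>I\<^sub>,\<^sub>l\<^sub><\<^sub>p \<Delta>\<^sub>l = (p - 1) + \<Sum>\<^sub>l\<^sub>\<notin>\<^sub>I\<^sub>,\<^sub>l\<^sub><\<^sub>p \<Delta>\<^sub>l\<close>. Summing over the sets \<open>I\<close> with \<open>k\<close> elements gives
  the law of the number of draws (\<open>prob_num_draws\<close>).

  Finally, sets with \<open>k\<close> elements correspond to increasing \<open>k\<close>-tuples
  (\<open>bij_betw_increasing_tuples_subsets\<close>), and the product splits into the factors with \<open>p \<in> I\<close> and
  those with \<open>p \<notin> I\<close>. For \<open>j = 1\<close> the sets that omit \<open>1\<close> contribute nothing, because the factor at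
  \<open>p = 1\<close> is \<open>0\<close>; this is the constraint \<open>i\<^sub>1 = 1\<close> on the tuples.

  All conditioning is on complete histories \<open>(C\<^sub>1, \<dots>, C\<^sub>t\<^sub>-\<^sub>1)\<close>, as in the law of the urn. The draw at
  time \<open>s\<close> almost surely has one of the colors \<open>1, \<dots>, s\<close> (\<open>AE_hist\<close>), so only finitely many histories
  matter and every event about the past is a finite disjoint union of single histories.
\<close>

section \<open>Composition of the urn\<close>

lemma balls_closed_form:
  "balls \<Delta> c n m = of_bool (1 \<le> m \<and> m \<le> n + 1) + (\<Sum>l=1..n. if c l = m then \<Delta> l else 0)"
  by (induction n) auto

lemma total_balls_closed_form:
  assumes "\<And>s. s \<in> {1..n} \<Longrightarrow> c s \<in> {1..s}"
  shows "total_balls \<Delta> c n = real (n + 1) + (\<Sum>l=1..n. \<Delta> l)"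
proof -
  have "total_balls \<Delta> c n
      = (\<Sum>m=1..n + 1. 1) + (\<Sum>m=1..n + 1. \<Sum>l=1..n. if c l = m then \<Delta> l else 0)"
    unfolding total_balls_def balls_closed_form sum.distrib by simp
  also have "(\<Sum>m=1..n + 1. \<Sum>l=1..n. if c l = m then \<Delta> l else 0)
      = (\<Sum>l=1..n. \<Sum>m=1..n + 1. if c l = m then \<Delta> l else 0)"
    by (rule sum.swap)
  also have "\<dots> = (\<Sum>l=1..n. \<Delta> l)"
  proof (rule sum.cong[OF refl])
    fix l assume l: "l \<in> {1..n}"
    then have "c l \<in> {1..n + 1}" using assms[of l] by auto
    then show "(\<Sum>m=1..n + 1. if c l = m then \<Delta> l else 0) = \<Delta> l" by simp
  qed
  finally show ?thesis by simp
qed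

section \<open>The law of the histories\<close>

text \<open>
  The possible outcomes of the draws strictly before time \<open>t\<close>. The index is that of the upcoming
  draw, so that \<open>histories t\<close> is what the draw at time \<open>t\<close> is conditioned on.
\<close>

definition histories :: "nat \<Rightarrow> (nat \<Rightarrow> nat) set" where
  "histories t = (\<Pi>\<^sub>E s\<in>{1..<t}. {1..s})"

definition total_before :: "(nat \<Rightarrow> real) \<Rightarrow> nat \<Rightarrow> real" where
  "total_before \<Delta> p = real p + (\<Sum>l\<in>{1..<p}. \<Delta> l)"

lemma finite_histories: "finite (histories t)"
  unfolding histories_def by (intro finite_PiE) auto

lemma total_balls_history:
  assumes "c \<in> histories t" "t \<ge> 1"
  shows "total_balls \<Delta> c (t - 1) = total_before \<Delta> t"
proof -
  have eq: "{1..t - 1} = {1..<t}" using assms(2) by auto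
  have "total_balls \<Delta> c (t - 1) = real (t - 1 + 1) + (\<Sum>l=1..t - 1. \<Delta> l)"
    using assms(1) unfolding histories_def eq[symmetric]
    by (intro total_balls_closed_form) (auto simp: PiE_iff)
  then show ?thesis using assms(2) by (simp only: total_before_def eq le_add_diff_inverse2)
qed

text \<open>
  A color that does not exist before time \<open>j\<close> cannot be drawn before time \<open>j\<close>, so from then on its
  amount is read off the draws at the times \<open>j, j + 1, \<dots>\<close>.
\<close>

lemma balls_history:
  assumes c: "c \<in> histories t" and j: "1 \<le> j" "j \<le> t"
    and I: "I \<subseteq> {j..}" and pattern: "\<And>n. n \<in> {j..<t} \<Longrightarrow> c n = j \<longleftrightarrow> n \<in> I"
  shows "balls \<Delta> c (t - 1) j = 1 + (\<Sum>l\<in>I \<inter> {1..<t}. \<Delta> l)"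
proof -
  have eq: "{1..t - 1} = {1..<t}" using j by auto
  have iff: "c l = j \<longleftrightarrow> l \<in> I" if l: "l \<in> {1..<t}" for l
  proof (cases "l < j")
    case True
    have "c l \<in> {1..l}" using c l unfolding histories_def by (auto simp: PiE_iff)
    then show ?thesis using True I by auto
  qed (use l pattern in auto)
  have "balls \<Delta> c (t - 1) j = 1 + (\<Sum>l\<in>{1..<t}. if c l = j then \<Delta> l else 0)"
    unfolding balls_closed_form eq using j by auto
  also have "(\<Sum>l\<in>{1..<t}. if c l = j then \<Delta> l else 0) = (\<Sum>l\<in>{1..<t}. if l \<in> I then \<Delta> l else 0)"
    using iff by (intro sum.cong) auto
  also have "\<dots> = (\<Sum>l\<in>{1..<t} \<inter> I. \<Delta> l)"
    by (rule sum.inter_restrict[symmetric]) simp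
  finally show ?thesis by (simp add: Int_commute)
qed

lemma (in prob_space) prob_split_by_value:
  assumes "finite B" and "\<And>b. b \<in> B \<Longrightarrow> {\<omega> \<in> space M. P \<omega> \<and> X \<omega> = b} \<in> events"
  shows "\<P>(\<omega> in M. P \<omega> \<and> X \<omega> \<in> B) = (\<Sum>b\<in>B. \<P>(\<omega> in M. P \<omega> \<and> X \<omega> = b))"
proof -
  have "{\<omega> \<in> space M. P \<omega> \<and> X \<omega> \<in> B} = (\<Union>b\<in>B. {\<omega> \<in> space M. P \<omega> \<and> X \<omega> = b})"
    by auto
  also have "prob \<dots> = (\<Sum>b\<in>B. \<P>(\<omega> in M. P \<omega> \<and> X \<omega> = b))"
    using assms by (intro finite_measure_finite_Union) (auto simp: disjoint_family_on_def)
  finally show ?thesis .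
qed

context expanding_polya_urn
begin

definition hist :: "nat \<Rightarrow> 'a \<Rightarrow> nat \<Rightarrow> nat" where
  "hist t \<omega> = restrict (\<lambda>s. C s \<omega>) {1..<t}"

lemma total_before_pos:
  assumes "p \<ge> 1"
  shows "total_before \<Delta> p > 0"
proof -
  have "(\<Sum>l\<in>{1..<p}. \<Delta> l) \<ge> 0"
    by (intro sum_nonneg less_imp_le[OF reinforcement_pos]) simp
  then show ?thesis using assms by (simp add: total_before_def add_pos_nonneg)
qed

lemma hist_eq_iff:
  assumes "c \<in> histories t"
  shows "hist t \<omega> = c \<longleftrightarrow> (\<forall>s\<in>{1..<t}. C s \<omega> = c s)"
proof
  assume "\<forall>s\<in>{1..<t}. C s \<omega> = c s"
  then show "hist t \<omega> = c"
    using assms unfolding histories_def hist_def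
    by (auto simp: fun_eq_iff restrict_def PiE_iff extensional_def)
qed (auto simp: hist_def)

lemma events_draw:
  assumes "t \<ge> 1"
  shows "{\<omega> \<in> space M. C t \<omega> = m} \<in> events"
  using draw_measurable[OF assms] by measurable

lemma events_hist_eq:
  assumes "c \<in> histories t"
  shows "{\<omega> \<in> space M. hist t \<omega> = c} \<in> events"
proof -
  have "{\<omega> \<in> space M. \<forall>s\<in>{1..<t}. C s \<omega> = c s} \<in> events"
  proof (rule sets.sets_Collect_finite_All)
    fix s assume "s \<in> {1..<t}"
    then have "1 \<le> s" by simp
    then show "{\<omega> \<in> space M. C s \<omega> = c s} \<in> events" by (rule events_draw)
  qed simp
  then show ?thesis unfolding hist_eq_iff[OF assms] .
qed

lemma events_hist:
  assumes "A \<subseteq> histories t"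
  shows "{\<omega> \<in> space M. hist t \<omega> \<in> A} \<in> events"
proof -
  have "{\<omega> \<in> space M. hist t \<omega> \<in> A} = (\<Union>c\<in>A. {\<omega> \<in> space M. hist t \<omega> = c})"
    by auto
  also have "\<dots> \<in> events"
    using assms finite_histories by (intro sets.finite_UN events_hist_eq) (auto intro: finite_subset)
  finally show ?thesis .
qed

lemma events_hist_draw:
  assumes "A \<subseteq> histories t" "t \<ge> 1"
  shows "{\<omega> \<in> space M. hist t \<omega> \<in> A \<and> C t \<omega> = m} \<in> events"
  by (intro sets.sets_Collect_conj events_hist events_draw assms)

text \<open>
  The law of the urn in product form. Unlike the conditional form it also covers histories of
  probability \<open>0\<close>, where both sides vanish, so it can be summed over all histories.
\<close>

lemma prob_hist_eq_draw:
  assumes c: "c \<in> histories t" and m: "1 \<le> m" "m \<le> t"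
  shows "\<P>(\<omega> in M. hist t \<omega> = c \<and> C t \<omega> = m)
    = \<P>(\<omega> in M. hist t \<omega> = c) * (balls \<Delta> c (t - 1) m / total_before \<Delta> t)"
proof (cases "\<P>(\<omega> in M. hist t \<omega> = c) = 0")
  case True
  have "\<P>(\<omega> in M. hist t \<omega> = c \<and> C t \<omega> = m) \<le> \<P>(\<omega> in M. hist t \<omega> = c)"
    using events_hist_eq[OF c] by (intro finite_measure_mono) auto
  then have "\<P>(\<omega> in M. hist t \<omega> = c \<and> C t \<omega> = m) = 0"
    using True by (intro antisym) simp_all
  then show ?thesis using True by simp
next
  case False
  then have pos: "\<P>(\<omega> in M. hist t \<omega> = c) > 0"
    using measure_nonneg by (simp add: order_less_le)
  have "\<P>(\<omega> in M. C t \<omega> = m \<bar> hist t \<omega> = c) = balls \<Delta> c (t - 1) m / total_before \<Delta> t"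
    using draw_law[of m t c] m pos total_balls_history[OF c]
    by (simp add: hist_eq_iff[OF c])
  then show ?thesis
    using pos by (simp add: cond_prob_def field_simps conj_commute)
qed

lemma prob_hist_draw:
  assumes A: "A \<subseteq> histories t" and m: "1 \<le> m" "m \<le> t"
  shows "\<P>(\<omega> in M. hist t \<omega> \<in> A \<and> C t \<omega> = m)
    = (\<Sum>c\<in>A. \<P>(\<omega> in M. hist t \<omega> = c) * (balls \<Delta> c (t - 1) m / total_before \<Delta> t))"
proof -
  have fin: "finite A" using A finite_histories by (rule finite_subset)
  have "{\<omega> \<in> space M. hist t \<omega> = c \<and> C t \<omega> = m} \<in> events" if "c \<in> A" for c
    using events_hist_draw[of "{c}" t m] that A m by auto
  then have "\<P>(\<omega> in M. C t \<omega> = m \<and> hist t \<omega> \<in> A)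
      = (\<Sum>c\<in>A. \<P>(\<omega> in M. C t \<omega> = m \<and> hist t \<omega> = c))"
    using fin by (intro prob_split_by_value) (simp_all add: conj_commute)
  then have "\<P>(\<omega> in M. hist t \<omega> \<in> A \<and> C t \<omega> = m)
      = (\<Sum>c\<in>A. \<P>(\<omega> in M. hist t \<omega> = c \<and> C t \<omega> = m))"
    by (simp add: conj_commute)
  also have "\<dots> = (\<Sum>c\<in>A. \<P>(\<omega> in M. hist t \<omega> = c) * (balls \<Delta> c (t - 1) m / total_before \<Delta> t))"
    using A m by (intro sum.cong prob_hist_eq_draw) auto
  finally show ?thesis .
qed

lemma prob_hist:
  assumes A: "A \<subseteq> histories t"
  shows "\<P>(\<omega> in M. hist t \<omega> \<in> A) = (\<Sum>c\<in>A. \<P>(\<omega> in M. hist t \<omega> = c))"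
proof -
  have fin: "finite A" using A finite_histories by (rule finite_subset)
  then show ?thesis
    using prob_split_by_value[of A "\<lambda>_. True" "hist t"] events_hist_eq A by auto
qed

text \<open>
  If all histories in an event of the past leave the same amount of color \<open>m\<close>, then that amount
  determines the conditional probability given the whole event. This is what allows conditioning on
  the draw times of a single color instead of on a full history.
\<close>

lemma prob_hist_draw_const:
  assumes A: "A \<subseteq> histories t" and m: "1 \<le> m" "m \<le> t"
    and b: "\<And>c. c \<in> A \<Longrightarrow> balls \<Delta> c (t - 1) m = b"
  shows "\<P>(\<omega> in M. hist t \<omega> \<in> A \<and> C t \<omega> = m)
    = \<P>(\<omega> in M. hist t \<omega> \<in> A) * (b / total_before \<Delta> t)"
  unfolding prob_hist_draw[OF A m] prob_hist[OF A] sum_distrib_right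
  by (intro sum.cong refl) (simp only: b)

lemma hist_Suc_in_histories_iff:
  assumes "t \<ge> 1"
  shows "hist (Suc t) \<omega> \<in> histories (Suc t) \<longleftrightarrow> hist t \<omega> \<in> histories t \<and> C t \<omega> \<in> {1..t}"
  using assms by (auto simp: hist_def histories_def PiE_iff less_Suc_eq)

text \<open>
  The law of the urn prescribes the probabilities of the colors \<open>1, \<dots>, t\<close> at time \<open>t\<close> only. Given a
  possible history they add up to \<open>1\<close>, because the total counts exactly these colors, and so nothing
  is left for any other value of \<open>C t\<close>.
\<close>

lemma AE_hist: "AE \<omega> in M. hist t \<omega> \<in> histories t"
proof (induction t)
  case 0
  show ?case by (simp add: hist_def histories_def)
next
  case (Suc t)
  show ?case
  proof (cases "t = 0")
    case True
    then show ?thesis by (simp add: hist_def histories_def)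
  next
    case False
    then have t: "t \<ge> 1" by simp
    let ?H = "histories t"
    let ?p = "\<lambda>c. \<P>(\<omega> in M. hist t \<omega> = c)"
    have total: "(\<Sum>m=1..t. balls \<Delta> c (t - 1) m / total_before \<Delta> t) = 1" if "c \<in> ?H" for c
      using total_balls_history[OF that t, of \<Delta>] total_before_pos[OF t] t
      by (simp add: total_balls_def flip: sum_divide_distrib)
    have "\<P>(\<omega> in M. hist (Suc t) \<omega> \<in> histories (Suc t))
        = (\<Sum>m=1..t. \<P>(\<omega> in M. hist t \<omega> \<in> ?H \<and> C t \<omega> = m))"
      unfolding hist_Suc_in_histories_iff[OF t]
      using events_hist_draw[OF order_refl t] by (intro prob_split_by_value) auto
    also have "\<dots> = (\<Sum>m=1..t. \<Sum>c\<in>?H. ?p c * (balls \<Delta> c (t - 1) m / total_before \<Delta> t))"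
      by (intro sum.cong prob_hist_draw) auto
    also have "\<dots> = (\<Sum>c\<in>?H. \<Sum>m=1..t. ?p c * (balls \<Delta> c (t - 1) m / total_before \<Delta> t))"
      by (rule sum.swap)
    also have "\<dots> = (\<Sum>c\<in>?H. ?p c)"
      by (intro sum.cong refl) (simp only: total mult_1_right flip: sum_distrib_left)
    also have "\<dots> = 1"
      using Suc.IH events_hist[of ?H t] by (simp add: prob_Collect_eq_1 flip: prob_hist)
    finally show ?thesis
      using events_hist[of "histories (Suc t)" "Suc t"] by (simp add: prob_Collect_eq_1)
  qed
qed

section \<open>The law of the set of draw times\<close>

definition histories_with :: "nat \<Rightarrow> nat set \<Rightarrow> nat \<Rightarrow> (nat \<Rightarrow> nat) set" where
  "histories_with j I t = {c \<in> histories t. \<forall>n\<in>{j..<t}. c n = j \<longleftrightarrow> n \<in> I}"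

lemma hist_Suc_in_histories_with_iff:
  assumes "1 \<le> j" "j \<le> t"
  shows "hist (Suc t) \<omega> \<in> histories_with j I (Suc t) \<longleftrightarrow>
    hist t \<omega> \<in> histories_with j I t \<and> C t \<omega> \<in> {1..t} \<and> (C t \<omega> = j \<longleftrightarrow> t \<in> I)"
proof -
  have "hist (Suc t) \<omega> n = hist t \<omega> n" if "n < t" for n
    using that by (auto simp: hist_def)
  moreover have "hist (Suc t) \<omega> t = C t \<omega>"
    using assms by (auto simp: hist_def)
  ultimately have "(\<forall>n\<in>{j..<Suc t}. hist (Suc t) \<omega> n = j \<longleftrightarrow> n \<in> I) \<longleftrightarrow>
      (\<forall>n\<in>{j..<t}. hist t \<omega> n = j \<longleftrightarrow> n \<in> I) \<and> (C t \<omega> = j \<longleftrightarrow> t \<in> I)"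
    using assms by (simp add: atLeastLessThanSuc conj_commute cong: conj_cong)
  then show ?thesis
    using assms hist_Suc_in_histories_iff[of t \<omega>] by (auto simp: histories_with_def)
qed

text \<open>
  The amount of color \<open>j\<close> before time \<open>p\<close> if \<open>p \<in> I\<close>, and of all other colors if \<open>p \<notin> I\<close>, when \<open>I\<close>
  is the set of draw times of color \<open>j\<close>. The color itself does not appear: it holds a single ball
  when it enters, whichever color it is.
\<close>

definition draw_weight :: "nat set \<Rightarrow> nat \<Rightarrow> real" where
  "draw_weight I p = (if p \<in> I then 1 + (\<Sum>l\<in>I \<inter> {1..<p}. \<Delta> l)
     else (real p - 1) + (\<Sum>l\<in>{1..<p} - I. \<Delta> l))"

text \<open>
  If \<open>t \<in> I\<close>, this is the probability of one more draw of color \<open>j\<close>. If \<open>t \<notin> I\<close>, the amounts of the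
  other colors vary between the histories, so the probability is obtained by subtraction from the
  first case.
\<close>

lemma prob_histories_with_Suc:
  assumes j: "1 \<le> j" "j \<le> t" and I: "I \<subseteq> {j..}"
  shows "\<P>(\<omega> in M. hist (Suc t) \<omega> \<in> histories_with j I (Suc t))
    = \<P>(\<omega> in M. hist t \<omega> \<in> histories_with j I t) * (draw_weight I t / total_before \<Delta> t)"
proof -
  let ?A = "histories_with j I t"
  let ?b = "1 + (\<Sum>l\<in>I \<inter> {1..<t}. \<Delta> l)"
  have A: "?A \<subseteq> histories t" by (auto simp: histories_with_def)
  have A': "histories_with j I (Suc t) \<subseteq> histories (Suc t)" by (auto simp: histories_with_def)
  have t: "t \<ge> 1" using j by simp
  have T: "total_before \<Delta> t > 0" using total_before_pos[OF t] .
  have draw: "\<P>(\<omega> in M. hist t \<omega> \<in> ?A \<and> C t \<omega> = j)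
      = \<P>(\<omega> in M. hist t \<omega> \<in> ?A) * (?b / total_before \<Delta> t)"
    using j I by (intro prob_hist_draw_const[OF A] balls_history) (auto simp: histories_with_def)
  show ?thesis
  proof (cases "t \<in> I")
    case True
    have "hist (Suc t) \<omega> \<in> histories_with j I (Suc t) \<longleftrightarrow> hist t \<omega> \<in> ?A \<and> C t \<omega> = j" for \<omega>
      using True j by (auto simp: hist_Suc_in_histories_with_iff)
    then show ?thesis using True draw by (simp add: draw_weight_def)
  next
    case False
    have "(\<Sum>l\<in>{1..<t}. \<Delta> l) = (\<Sum>l\<in>{1..<t} - I. \<Delta> l) + (\<Sum>l\<in>I \<inter> {1..<t}. \<Delta> l)"
      using sum.Int_Diff[of "{1..<t}" \<Delta> I] by (simp add: Int_commute)
    then have weight: "draw_weight I t = total_before \<Delta> t - ?b"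
      using False by (simp add: draw_weight_def total_before_def)
    have "\<P>(\<omega> in M. hist (Suc t) \<omega> \<in> histories_with j I (Suc t))
        = prob ({\<omega> \<in> space M. hist t \<omega> \<in> ?A} - {\<omega> \<in> space M. hist t \<omega> \<in> ?A \<and> C t \<omega> = j})"
    proof (rule finite_measure_eq_AE)
      show "AE \<omega> in M. \<omega> \<in> {\<omega> \<in> space M. hist (Suc t) \<omega> \<in> histories_with j I (Suc t)} \<longleftrightarrow>
          \<omega> \<in> {\<omega> \<in> space M. hist t \<omega> \<in> ?A} - {\<omega> \<in> space M. hist t \<omega> \<in> ?A \<and> C t \<omega> = j}"
        using AE_hist[of "Suc t"]
      proof eventually_elim
        case (elim \<omega>)
        then show ?case
          using j False by (auto simp: hist_Suc_in_histories_with_iff hist_Suc_in_histories_iff)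
      qed
    qed (use events_hist[OF A'] events_hist[OF A] events_hist_draw[OF A t] in auto)
    also have "\<dots> = \<P>(\<omega> in M. hist t \<omega> \<in> ?A) - \<P>(\<omega> in M. hist t \<omega> \<in> ?A \<and> C t \<omega> = j)"
      using events_hist[OF A] events_hist_draw[OF A t] by (intro finite_measure_Diff) auto
    also have "\<dots> = \<P>(\<omega> in M. hist t \<omega> \<in> ?A) * (draw_weight I t / total_before \<Delta> t)"
      unfolding draw weight using T by (simp add: field_simps)
    finally show ?thesis .
  qed
qed

lemma prob_histories_with:
  assumes j: "1 \<le> j" and I: "I \<subseteq> {j..}" and t: "j \<le> t"
  shows "\<P>(\<omega> in M. hist t \<omega> \<in> histories_with j I t)
    = (\<Prod>p\<in>{j..<t}. draw_weight I p / total_before \<Delta> p)"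
  using t
proof (induction t rule: dec_induct)
  case base
  have "histories_with j I j = histories j" by (simp add: histories_with_def)
  then show ?case
    using AE_hist[of j] events_hist[of "histories j" j] by (simp add: prob_Collect_eq_1)
next
  case (step t)
  then show ?case
    using j I by (simp add: prob_histories_with_Suc)
qed

lemma num_draws_eq_card: "num_draws C j t \<omega> = card {n \<in> {j..t}. C n \<omega> = j}"
  unfolding num_draws_def drawn_def by (simp add: sum.If_cases Int_def)

lemma prob_num_draws:
  assumes j: "1 \<le> j" "j \<le> t"
  shows "\<P>(\<omega> in M. num_draws C j t \<omega> = k)
    = (\<Sum>I | I \<subseteq> {j..t} \<and> card I = k. \<Prod>p=j..t. draw_weight I p / total_before \<Delta> p)"
proof -
  let ?S = "{I. I \<subseteq> {j..t} \<and> card I = k}"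
  let ?E = "\<lambda>I. {\<omega> \<in> space M. hist (Suc t) \<omega> \<in> histories_with j I (Suc t)}"
  have fin: "finite ?S" by (rule finite_subset[of _ "Pow {j..t}"]) auto
  \<comment> \<open>On possible histories the events \<open>?E I\<close> say that \<open>I\<close> is exactly the set of draw times.\<close>
  have E_iff: "hist (Suc t) \<omega> \<in> histories_with j I (Suc t) \<longleftrightarrow> {n \<in> {j..t}. C n \<omega> = j} = I"
    if "I \<subseteq> {j..t}" "hist (Suc t) \<omega> \<in> histories (Suc t)" for I \<omega>
  proof -
    have "hist (Suc t) \<omega> n = C n \<omega>" if "n \<in> {j..<Suc t}" for n
      using that j by (simp add: hist_def)
    then have "hist (Suc t) \<omega> \<in> histories_with j I (Suc t) \<longleftrightarrow> (\<forall>n\<in>{j..t}. C n \<omega> = j \<longleftrightarrow> n \<in> I)"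
      using \<open>hist (Suc t) \<omega> \<in> histories (Suc t)\<close> by (simp add: histories_with_def atLeastLessThanSuc_atLeastAtMost)
    also have "\<dots> \<longleftrightarrow> {n \<in> {j..t}. C n \<omega> = j} = I" using \<open>I \<subseteq> {j..t}\<close> by blast
    finally show ?thesis .
  qed
  have E_events: "?E I \<in> events" for I
    by (rule events_hist) (auto simp: histories_with_def)
  have "\<P>(\<omega> in M. num_draws C j t \<omega> = k) = prob (\<Union>I\<in>?S. ?E I)"
  proof (rule finite_measure_eq_AE)
    show "AE \<omega> in M. \<omega> \<in> {\<omega> \<in> space M. num_draws C j t \<omega> = k} \<longleftrightarrow> \<omega> \<in> (\<Union>I\<in>?S. ?E I)"
      using AE_hist[of "Suc t"]
    proof eventually_elim
      case (elim \<omega>)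
      show ?case
        using E_iff[OF _ elim] by (auto simp: num_draws_eq_card)
    qed
    have "num_draws C j t \<in> measurable M (count_space UNIV)"
    proof -
      have "(\<lambda>\<omega>. drawn C j n \<omega>) \<in> measurable M (count_space UNIV)" if "n \<in> {j..t}" for n
      proof -
        have [measurable]: "C n \<in> measurable M (count_space UNIV)"
          using that j by (intro draw_measurable) auto
        show ?thesis unfolding drawn_def by measurable
      qed
      then show ?thesis
        unfolding num_draws_def[abs_def] by (intro measurable_sum_nat) auto
    qed
    then show "{\<omega> \<in> space M. num_draws C j t \<omega> = k} \<in> events" by measurable
    show "(\<Union>I\<in>?S. ?E I) \<in> events" using fin E_events by (intro sets.finite_UN) auto
  qed
  also have "\<dots> = (\<Sum>I\<in>?S. prob (?E I))"
  proof (rule finite_measure_finite_Union[OF fin])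
    show "disjoint_family_on ?E ?S"
      unfolding disjoint_family_on_def
    proof (intro ballI impI)
      fix I J assume IJ: "I \<in> ?S" "J \<in> ?S" "I \<noteq> J"
      have "\<omega> \<notin> ?E J" if "\<omega> \<in> ?E I" for \<omega>
      proof -
        have "hist (Suc t) \<omega> \<in> histories (Suc t)"
          using that by (simp add: histories_with_def)
        then show ?thesis using E_iff[of I \<omega>] E_iff[of J \<omega>] IJ that by simp
      qed
      then show "?E I \<inter> ?E J = {}" by (intro disjoint_iff[THEN iffD2] allI impI)
    qed
  qed (use E_events in \<open>simp add: image_subset_iff\<close>)
  also have "\<dots> = (\<Sum>I\<in>?S. \<Prod>p=j..t. draw_weight I p / total_before \<Delta> p)"
    using j by (intro sum.cong refl)
      (subst prob_histories_with, auto simp: atLeastLessThanSuc_atLeastAtMost)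
  finally show ?thesis .
qed

end

section \<open>From sets of draw times to increasing tuples\<close>

text \<open>
  Injectivity holds because the image determines the tuple: the entry in position \<open>a\<close> is
  the element of the image with exactly \<open>a - 1\<close> elements below it. Sorting a set gives the tuple with
  that image.
\<close>

lemma bij_betw_increasing_tuples_subsets:
  fixes k :: nat and X :: "'b::linorder set"
  assumes "finite X"
  shows "bij_betw (\<lambda>i. i ` {1..k})
    {i \<in> {1..k} \<rightarrow>\<^sub>E X. strict_mono_on {1..k} i} {I. I \<subseteq> X \<and> card I = k}"
proof (rule bij_betw_imageI)
  show "inj_on (\<lambda>i. i ` {1..k}) {i \<in> {1..k} \<rightarrow>\<^sub>E X. strict_mono_on {1..k} i}"
  proof (rule inj_onI, clarify)
    fix i i' assume i: "i \<in> {1..k} \<rightarrow>\<^sub>E X" "strict_mono_on {1..k} i"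
      and i': "i' \<in> {1..k} \<rightarrow>\<^sub>E X" "strict_mono_on {1..k} i'"
      and eq: "i ` {1..k} = i' ` {1..k}"
    have rank: "card {x \<in> f ` {1..k}. x < f a} = a - 1"
      if f: "strict_mono_on {1..k} f" and a: "a \<in> {1..k}" for f :: "nat \<Rightarrow> 'b" and a
    proof -
      have "{x \<in> f ` {1..k}. x < f a} = f ` {1..<a}"
        using a strict_mono_on_less[OF f] by auto
      moreover have "inj_on f {1..<a}"
        using strict_mono_on_imp_inj_on[OF f] a by (auto intro: inj_on_subset)
      ultimately show ?thesis by (simp add: card_image)
    qed
    show "i = i'"
    proof (rule PiE_ext[OF i(1) i'(1)])
      fix a assume a: "a \<in> {1..k}"
      then obtain b where b: "b \<in> {1..k}" "i a = i' b" using eq by blast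
      have "a - 1 = b - 1"
        using rank[OF i(2) a] rank[OF i'(2) b(1)] eq b(2) by simp
      then have "a = b" using a b(1) by auto
      then show "i a = i' a" using b(2) by simp
    qed
  qed
next
  show "(\<lambda>i. i ` {1..k}) ` {i \<in> {1..k} \<rightarrow>\<^sub>E X. strict_mono_on {1..k} i} = {I. I \<subseteq> X \<and> card I = k}"
  proof (intro equalityI subsetI)
    fix I assume "I \<in> (\<lambda>i. i ` {1..k}) ` {i \<in> {1..k} \<rightarrow>\<^sub>E X. strict_mono_on {1..k} i}"
    then show "I \<in> {I. I \<subseteq> X \<and> card I = k}"
      by (auto simp: card_image dest: strict_mono_on_imp_inj_on)
  next
    fix I assume I: "I \<in> {I. I \<subseteq> X \<and> card I = k}"
    let ?xs = "sorted_list_of_set I"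
    let ?i = "restrict (\<lambda>a. ?xs ! (a - 1)) {1..k}"
    have fin: "finite I" using I assms by (auto intro: finite_subset)
    have len: "length ?xs = k" using I fin by simp
    have img: "?i ` {1..k} = I"
    proof -
      have "?i ` {1..k} = (\<lambda>a. ?xs ! a) ` (\<lambda>a. a - 1) ` {1..k}" by (auto simp: image_image)
      also have "(\<lambda>a. a - 1) ` {1..k} = {0..<k}"
        by (force simp: image_iff intro: bexI[of _ "Suc _"])
      also have "(\<lambda>a. ?xs ! a) ` {0..<k} = set ?xs"
        using len by (simp add: set_conv_nth image_def Bex_def) metis
      finally show ?thesis using fin by simp
    qed
    have "strict_mono_on {1..k} ?i"
      using len by (auto simp: strict_mono_on_def intro!: sorted_wrt_nth_less[of "(<)"])
    then have "?i \<in> {i \<in> {1..k} \<rightarrow>\<^sub>E X. strict_mono_on {1..k} i}"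
      using img I by auto
    then show "I \<in> (\<lambda>i. i ` {1..k}) ` {i \<in> {1..k} \<rightarrow>\<^sub>E X. strict_mono_on {1..k} i}"
      using img by (metis (no_types, lifting) image_eqI)
  qed
qed

text \<open>
  Bounding the first and last entries of an increasing tuple bounds all entries, and if the entries
  are at least \<open>1\<close>, then the first one is \<open>1\<close> as soon as any entry is. This turns the two cases of
  the index set into one family of tuples in \<open>{j..t}\<close>, with a side condition for \<open>j = 1\<close>.
\<close>

lemma draw_times_eq:
  assumes "1 \<le> j" "1 \<le> k"
  shows "draw_times j k t
    = {i \<in> {1..k} \<rightarrow>\<^sub>E {j..t}. strict_mono_on {1..k} i \<and> (j = 1 \<longrightarrow> 1 \<in> i ` {1..k})}"
proof -
  have bounds: "i 1 \<le> i a \<and> i a \<le> i k" if "strict_mono_on {1..k} i" "a \<in> {1..k}" for i :: "nat \<Rightarrow> nat" and a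
    using strict_mono_on_leD[OF that(1), of 1 a] strict_mono_on_leD[OF that(1), of a k] that(2) by auto
  have ends: "1 \<in> {1..k}" "k \<in> {1..k}" using assms(2) by auto
  have range: "i \<in> {1..k} \<rightarrow>\<^sub>E {j..t} \<longleftrightarrow> i \<in> {1..k} \<rightarrow>\<^sub>E UNIV \<and> j \<le> i 1 \<and> i k \<le> t"
    if mono: "strict_mono_on {1..k} i" for i
  proof
    assume "i \<in> {1..k} \<rightarrow>\<^sub>E UNIV \<and> j \<le> i 1 \<and> i k \<le> t"
    moreover from this have "i a \<in> {j..t}" if "a \<in> {1..k}" for a
      using bounds[OF mono that] by auto
    ultimately show "i \<in> {1..k} \<rightarrow>\<^sub>E {j..t}" by (simp add: PiE_iff)
  qed (use ends in \<open>auto simp: PiE_iff\<close>)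
  have first: "i 1 = 1 \<longleftrightarrow> 1 \<le> i 1 \<and> 1 \<in> i ` {1..k}"
    if mono: "strict_mono_on {1..k} i" for i :: "nat \<Rightarrow> nat"
  proof
    assume "1 \<le> i 1 \<and> 1 \<in> i ` {1..k}"
    then obtain a where "a \<in> {1..k}" "i a = 1" "1 \<le> i 1" by auto
    then show "i 1 = 1" using bounds[OF mono, of a] by simp
  next
    assume "i 1 = 1"
    then show "1 \<le> i 1 \<and> 1 \<in> i ` {1..k}" using ends(1) by (metis image_eqI order_refl)
  qed
  show ?thesis
  proof (cases "j = 1")
    case True
    then show ?thesis unfolding draw_times_def using range first by auto
  next
    case False
    then show ?thesis unfolding draw_times_def using range by auto
  qed
qed

text \<open>
  The entries before position \<open>a\<close> are the elements of the image below the \<open>a\<close>-th entry, so a product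
  over positions with factors depending on the preceding entries is a product over the image.
\<close>

lemma prod_increasing_tuple:
  fixes i :: "nat \<Rightarrow> 'b::linorder" and h :: "'b set \<Rightarrow> 'c::comm_monoid_mult"
  assumes "strict_mono_on {1..k} i"
  shows "(\<Prod>a=1..k. h (i ` {1..<a})) = (\<Prod>p\<in>i ` {1..k}. h (i ` {1..k} \<inter> {..<p}))"
proof -
  have "i ` {1..<a} = i ` {1..k} \<inter> {..<i a}" if "a \<in> {1..k}" for a
    using that strict_mono_on_less[OF assms] by auto
  then have "(\<Prod>a=1..k. h (i ` {1..<a})) = (\<Prod>a=1..k. h (i ` {1..k} \<inter> {..<i a}))"
    by (intro prod.cong refl) metis
  then show ?thesis
    unfolding prod.reindex[OF strict_mono_on_imp_inj_on[OF assms]] by simp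
qed

context expanding_polya_urn
begin

lemma prod_draw_weight_tuple:
  fixes i :: "nat \<Rightarrow> nat"
  assumes j: "1 \<le> j" and i: "i \<in> {1..k} \<rightarrow>\<^sub>E {j..t}" "strict_mono_on {1..k} i"
  shows "(\<Prod>p=j..t. draw_weight (i ` {1..k}) p)
    = (\<Prod>a=1..k. 1 + (\<Sum>b\<in>{1..<a}. \<Delta> (i b))) *
      (\<Prod>p\<in>{j..t} - i ` {1..k}. (real p - 1) + (\<Sum>l\<in>{1..<p} - i ` {1..k}. \<Delta> l))"
proof -
  let ?I = "i ` {1..k}"
  have sub: "?I \<subseteq> {j..t}" using i(1) by auto
  have low: "?I \<inter> {..<p} = ?I \<inter> {1..<p}" for p using sub j by auto
  have "(\<Prod>a=1..k. 1 + (\<Sum>b\<in>{1..<a}. \<Delta> (i b))) = (\<Prod>a=1..k. 1 + (\<Sum>l\<in>i ` {1..<a}. \<Delta> l))"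
  proof (rule prod.cong[OF refl])
    fix a assume "a \<in> {1..k}"
    then have "inj_on i {1..<a}"
      by (intro inj_on_subset[OF strict_mono_on_imp_inj_on[OF i(2)]]) auto
    then show "1 + (\<Sum>b\<in>{1..<a}. \<Delta> (i b)) = 1 + (\<Sum>l\<in>i ` {1..<a}. \<Delta> l)"
      unfolding sum.reindex[OF \<open>inj_on i {1..<a}\<close>] by simp
  qed
  also have "\<dots> = (\<Prod>p\<in>?I. 1 + (\<Sum>l\<in>?I \<inter> {1..<p}. \<Delta> l))"
    by (rule prod_increasing_tuple[OF i(2), of "\<lambda>J. 1 + sum \<Delta> J", unfolded low])
  also have "\<dots> = (\<Prod>p\<in>?I. draw_weight ?I p)"
    by (intro prod.cong) (auto simp: draw_weight_def)
  finally have drawn: "(\<Prod>a=1..k. 1 + (\<Sum>b\<in>{1..<a}. \<Delta> (i b))) = (\<Prod>p\<in>?I. draw_weight ?I p)" .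
  have "(\<Prod>p\<in>{j..t} - ?I. (real p - 1) + (\<Sum>l\<in>{1..<p} - ?I. \<Delta> l))
      = (\<Prod>p\<in>{j..t} - ?I. draw_weight ?I p)"
    by (intro prod.cong) (auto simp: draw_weight_def)
  then show ?thesis
    using prod.subset_diff[OF sub finite_atLeastAtMost, of "draw_weight ?I"]
    unfolding drawn by (simp only: mult.commute)
qed

lemma prod_total_before:
  assumes "1 \<le> j" "j \<le> t"
  shows "(\<Prod>n=j - 1..t - 1. (real n + 1) + (\<Sum>m=1..n. \<Delta> m)) = (\<Prod>p=j..t. total_before \<Delta> p)"
proof -
  have "(\<Prod>p=Suc (j - 1)..Suc (t - 1). total_before \<Delta> p)
      = (\<Prod>n=j - 1..t - 1. total_before \<Delta> (Suc n))"
    by (rule prod.shift_bounds_cl_Suc_ivl)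
  then show ?thesis
    using assms by (simp add: total_before_def atLeastLessThanSuc_atLeastAtMost add.commute)
qed

text \<open>
  Before time \<open>1\<close> the urn holds the ball of color \<open>1\<close> and nothing else, so a set of draw times of
  color \<open>1\<close> that omits time \<open>1\<close> has weight \<open>0\<close>.
\<close>

lemma draw_weight_first_draw:
  assumes "1 \<notin> I"
  shows "draw_weight I 1 = 0"
  using assms by (simp add: draw_weight_def)

lemma prob_num_draws_tuples:
  assumes j: "1 \<le> j" "j \<le> t" and k: "1 \<le> k"
  shows "\<P>(\<omega> in M. num_draws C j t \<omega> = k)
    = (\<Sum>i\<in>draw_times j k t. \<Prod>p=j..t. draw_weight (i ` {1..k}) p / total_before \<Delta> p)"
proof -
  let ?w = "\<lambda>I. \<Prod>p=j..t. draw_weight I p / total_before \<Delta> p"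
  let ?T = "{i \<in> {1..k} \<rightarrow>\<^sub>E {j..t}. strict_mono_on {1..k} i}"
  have "\<P>(\<omega> in M. num_draws C j t \<omega> = k) = (\<Sum>I | I \<subseteq> {j..t} \<and> card I = k. ?w I)"
    using j by (rule prob_num_draws)
  also have "\<dots> = (\<Sum>i\<in>?T. ?w (i ` {1..k}))"
    by (rule sum.reindex_bij_betw[OF bij_betw_increasing_tuples_subsets, symmetric]) simp
  also have "\<dots> = (\<Sum>i\<in>draw_times j k t. ?w (i ` {1..k}))"
  proof (rule sum.mono_neutral_right)
    show "finite ?T"
      by (rule finite_subset[of _ "{1..k} \<rightarrow>\<^sub>E {j..t}"]) (auto intro: finite_PiE)
    show "draw_times j k t \<subseteq> ?T"
      using draw_times_eq[OF j(1) k] by auto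
    show "\<forall>i\<in>?T - draw_times j k t. ?w (i ` {1..k}) = 0"
    proof
      fix i assume "i \<in> ?T - draw_times j k t"
      then have "j = 1" "1 \<notin> i ` {1..k}"
        unfolding draw_times_eq[OF j(1) k] by auto
      then have "j \<in> {j..t}" "draw_weight (i ` {1..k}) j / total_before \<Delta> j = 0"
        using j draw_weight_first_draw by auto
      then show "?w (i ` {1..k}) = 0" by (intro prod_zero) auto
    qed
  qed
  finally show ?thesis .
qed

end

theorem theorem1:
  fixes M :: "'a measure" and \<Delta> :: "nat \<Rightarrow> real" and C :: "nat \<Rightarrow> 'a \<Rightarrow> nat"
    and t j :: nat
  assumes "expanding_polya_urn M \<Delta> C"
    and "t \<ge> 1" and "1 \<le> j" and "j \<le> t"
  shows "(\<forall>k. 1 \<le> k \<and> k \<le> t - j + 1 \<longrightarrow>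
      \<P>(\<omega> in M. num_draws C j t \<omega> = k) =
        (\<Sum>i\<in>draw_times j k t.
          ((\<Prod>a=1..k. 1 + (\<Sum>b\<in>{1..<a}. \<Delta> (i b))) *
           (\<Prod>p\<in>{j..t} - i ` {1..k}. (real p - 1) + (\<Sum>l\<in>{1..<p} - i ` {1..k}. \<Delta> l)))
          / (\<Prod>n=j - 1..t - 1. (real n + 1) + (\<Sum>m=1..n. \<Delta> m))))
    \<and> \<P>(\<omega> in M. num_draws C j t \<omega> = 0) =
        (\<Prod>p=j..t. (real p - 1) + (\<Sum>l\<in>{1..<p}. \<Delta> l))
        / (\<Prod>n=j - 1..t - 1. (real n + 1) + (\<Sum>m=1..n. \<Delta> m))"
proof (intro conjI allI impI)
  interpret expanding_polya_urn M \<Delta> C by (rule assms(1))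
  note j = \<open>1 \<le> j\<close> \<open>j \<le> t\<close>
  show "\<P>(\<omega> in M. num_draws C j t \<omega> = k) =
        (\<Sum>i\<in>draw_times j k t.
          ((\<Prod>a=1..k. 1 + (\<Sum>b\<in>{1..<a}. \<Delta> (i b))) *
           (\<Prod>p\<in>{j..t} - i ` {1..k}. (real p - 1) + (\<Sum>l\<in>{1..<p} - i ` {1..k}. \<Delta> l)))
          / (\<Prod>n=j - 1..t - 1. (real n + 1) + (\<Sum>m=1..n. \<Delta> m)))"
    if k: "1 \<le> k \<and> k \<le> t - j + 1" for k
    unfolding prod_total_before[OF j] prob_num_draws_tuples[OF j conjunct1[OF k]] prod_dividef
  proof (rule sum.cong[OF refl])
    fix i assume "i \<in> draw_times j k t"
    then have "i \<in> {1..k} \<rightarrow>\<^sub>E {j..t}" "strict_mono_on {1..k} i"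
      unfolding draw_times_eq[OF j(1) conjunct1[OF k]] by blast+
    then show "(\<Prod>p=j..t. draw_weight (i ` {1..k}) p) / prod (total_before \<Delta>) {j..t} =
        ((\<Prod>a=1..k. 1 + (\<Sum>b\<in>{1..<a}. \<Delta> (i b))) *
         (\<Prod>p\<in>{j..t} - i ` {1..k}. (real p - 1) + (\<Sum>l\<in>{1..<p} - i ` {1..k}. \<Delta> l)))
        / prod (total_before \<Delta>) {j..t}"
      by (simp only: prod_draw_weight_tuple[OF j(1)])
  qed
  \<comment> \<open>For \<open>k = 0\<close> the only set of draw times is the empty one, so no tuples are involved.\<close>
  have "{I. I \<subseteq> {j..t} \<and> card I = 0} = {{}}"
    by (auto simp: card_eq_0_iff finite_subset[OF _ finite_atLeastAtMost])
  then show "\<P>(\<omega> in M. num_draws C j t \<omega> = 0) =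
        (\<Prod>p=j..t. (real p - 1) + (\<Sum>l\<in>{1..<p}. \<Delta> l))
        / (\<Prod>n=j - 1..t - 1. (real n + 1) + (\<Sum>m=1..n. \<Delta> m))"
    unfolding prod_total_before[OF j] prob_num_draws[OF j] prod_dividef
    by (simp add: draw_weight_def)
qed

end
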